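(* Let $P$ be a finite set of players partitioned into $m$ disjoint subsets $P=P_1\cup\dots\cup P_m$, with $n_i=|P_i|$, and let $k_1<k_2<\dots<k_m$ be positive integers. Let $H$ be the disjunctive hierarchical game on $P$ with this partition and these thresholds, i.e. $X\subseteq P$ is winning iff there exists $i\in\{1,\dots,m\}$ with $|X\cap(P_1\cup\dots\cup P_i)|\ge k_i$. Then the equivalence relation $\sim_H$ has exactly $m$ equivalence classes (so that the canonical representation of $H$ is defined on the multiset $\{1^{n_1},\dots,m^{n_m}\}$) if and only if (a) $k_1\le n_1$, and (b) $k_i<k_{i-1}+n_i$ for every $1<i<m$. Suppose (a) and (b) hold. Then the sequence $(k_1,\dots,k_{m-1})$ is uniquely determined: if $k'_1<\dots<k'_m$ are positive integers such that the disjunctive hierarchical game on $P$ with the same partition and thresholds $k'_1,\dots,k'_m$ equals $H$, then $k'_i=k_i$ for all $1\le i\le m-1$. Moreover, $H$ has no dummy players if and only if $k_m<k_{m-1}+n_m$, and in this case $k_m$ is uniquely determined as well (i.e. also $k'_m=k_m$ for any such $k'$); if $k_m\ge k_{m-1}+n_m$, then every player of $P_m$ is a dummy.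
   Context: A simple game on a finite set $P$ is a pair $(P,W)$ where $W$ is a nonempty family of subsets of $P$ (the winning coalitions) such that $X\in W$ and $X\subseteq Y\subseteq P$ imply $Y\in W$; other coalitions are losing. A player is a dummy if it belongs to no minimal winning coalition. For a simple game $G$, the relation $\sim_G$ on $P$ is defined by $i\sim_G j$ iff for every $X\subseteq P$ containing neither $i$ nor $j$, $X\cup\{i\}\in W\iff X\cup\{j\}\in W$; it is an equivalence relation. If the equivalence classes have sizes $n_1,\dots,n_m$, the canonical representation of $G$ is the game on the multiset $\{1^{n_1},\dots,m^{n_m}\}$ in which a submultiset $\{1^{\ell_1},\dots,m^{\ell_m}\}$ is winning iff a coalition containing $\ell_i$ players from the $i$-th class for each $i$ is winning in $G$. *)

theory Defs
  imports Main "HOL-Library.Multiset" "HOL-Library.Disjoint_Sets"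
begin

text \<open>A game is given by its player set \<open>P\<close> and its family \<open>W\<close> of winning coalitions.\<close>

definition simple_game :: "'a set \<Rightarrow> 'a set set \<Rightarrow> bool" where
  "simple_game P W \<longleftrightarrow>
     finite P \<and> W \<subseteq> Pow P \<and> W \<noteq> {} \<and>
     (\<forall>X Y. X \<in> W \<and> X \<subseteq> Y \<and> Y \<subseteq> P \<longrightarrow> Y \<in> W)"

definition minimal_winning :: "'a set set \<Rightarrow> 'a set \<Rightarrow> bool" where
  "minimal_winning W X \<longleftrightarrow> X \<in> W \<and> (\<forall>Y. Y \<subset> X \<longrightarrow> Y \<notin> W)"

definition dummy :: "'a set \<Rightarrow> 'a set set \<Rightarrow> 'a \<Rightarrow> bool" where
  "dummy P W p \<longleftrightarrow> p \<in> P \<and> \<not> (\<exists>X. minimal_winning W X \<and> p \<in> X)"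

definition player_equiv :: "'a set \<Rightarrow> 'a set set \<Rightarrow> ('a \<times> 'a) set" where
  "player_equiv P W =
     {(i, j). i \<in> P \<and> j \<in> P \<and>
        (\<forall>X. X \<subseteq> P \<and> i \<notin> X \<and> j \<notin> X \<longrightarrow>
           (X \<union> {i} \<in> W \<longleftrightarrow> X \<union> {j} \<in> W))}"

definition power_multiset :: "nat \<Rightarrow> (nat \<Rightarrow> nat) \<Rightarrow> nat multiset" where
  "power_multiset m n = (\<Sum>i\<in>{1..m}. replicate_mset (n i) i)"

text \<open>
  The equivalence classes come without a preferred order, so \<open>(M, V)\<close> is a canonical
  representation if it arises from some enumeration \<open>C 1, \<dots>, C m\<close> of them.
\<close>

definition canonical_representation ::
    "'a set \<Rightarrow> 'a set set \<Rightarrow> nat \<Rightarrow> nat multiset \<Rightarrow> nat multiset set \<Rightarrow> bool" where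
  "canonical_representation P W m M V \<longleftrightarrow>
     (\<exists>C. bij_betw C {1..m} (P // player_equiv P W) \<and>
          M = power_multiset m (\<lambda>i. card (C i)) \<and>
          V = {L. L \<subseteq># M \<and> (\<exists>X\<in>W. \<forall>i\<in>{1..m}. card (X \<inter> C i) = count L i)})"

text \<open>Only the values of \<open>Part\<close> and \<open>k\<close> on \<open>{1..m}\<close> matter below.\<close>

definition indexed_partition :: "'a set \<Rightarrow> nat \<Rightarrow> (nat \<Rightarrow> 'a set) \<Rightarrow> bool" where
  "indexed_partition P m Part \<longleftrightarrow>
     P = (\<Union>i\<in>{1..m}. Part i) \<and> disjoint_family_on Part {1..m} \<and>
     (\<forall>i\<in>{1..m}. Part i \<noteq> {})"

definition thresholds :: "nat \<Rightarrow> (nat \<Rightarrow> nat) \<Rightarrow> bool" where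
  "thresholds m k \<longleftrightarrow> (\<forall>i\<in>{1..m}. 0 < k i) \<and> strict_mono_on {1..m} k"

definition disjunctive_hierarchical ::
    "'a set \<Rightarrow> nat \<Rightarrow> (nat \<Rightarrow> 'a set) \<Rightarrow> (nat \<Rightarrow> nat) \<Rightarrow> 'a set set" where
  "disjunctive_hierarchical P m Part k =
     {X. X \<subseteq> P \<and> (\<exists>i\<in>{1..m}. k i \<le> card (X \<inter> (\<Union>j\<in>{1..i}. Part j)))}"

end

theory Submission imports Defs begin

text \<open>
  Call the \<open>i\<close>-th threshold \<^emph>\<open>active\<close> if \<open>k i < k (i - 1) + n
  i\<close>, where \<open>k 0\<close> is read as \<open>1\<close>. An inactive threshold is
  redundant, because reaching it forces an earlier one to be reached (the first threshold, if
  inactive, is never reached); then \<open>Part i\<close> and \<open>Part (i + 1)\<close> are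
  interchangeable, or, for \<open>i = m\<close>, the players of \<open>Part m\<close> are dummies.
  If the thresholds \<open>1, \<dots>, i\<close> are all active, then taking \<open>k 1 - 1\<close>
  players from \<open>Part 1\<close>, \<open>k j - k (j - 1)\<close> players from each later
  \<open>Part j\<close> with \<open>j \<le> i\<close>, and one more player of \<open>Part i\<close>
  gives a coalition of size \<open>k i\<close> that reaches threshold \<open>i\<close> and no
  earlier one. It is a minimal winning coalition, it separates \<open>Part i\<close> from all later
  parts, and it shows that the game determines \<open>k i\<close> once it determines the earlier
  thresholds.
\<close>

section \<open>Thresholds, and interchangeability of players as an equivalence relation\<close>

lemma thresholds_less:
  "thresholds m k \<Longrightarrow> i \<in> {1..m} \<Longrightarrow> j \<in> {1..m} \<Longrightarrow> i < j \<Longrightarrow> k i < k j"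
  unfolding thresholds_def strict_mono_on_def by blast

lemma thresholds_le:
  "thresholds m k \<Longrightarrow> i \<in> {1..m} \<Longrightarrow> j \<in> {1..m} \<Longrightarrow> i \<le> j \<Longrightarrow> k i \<le> k j"
  using thresholds_less[of m k i j] by (cases "i = j") auto

lemma thresholds_pos: "thresholds m k \<Longrightarrow> i \<in> {1..m} \<Longrightarrow> 0 < k i"
  unfolding thresholds_def by blast

lemma player_equiv_refl: "i \<in> P \<Longrightarrow> (i, i) \<in> player_equiv P W"
  unfolding player_equiv_def by simp

lemma player_equiv_sym: "(i, j) \<in> player_equiv P W \<Longrightarrow> (j, i) \<in> player_equiv P W"
  unfolding player_equiv_def by auto

lemma player_equivD:
  assumes "(i, j) \<in> player_equiv P W" "X \<subseteq> P" "i \<notin> X" "j \<notin> X"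
  shows "insert i X \<in> W \<longleftrightarrow> insert j X \<in> W"
  using assms unfolding player_equiv_def by simp

text \<open>The delicate case is a test coalition \<open>X\<close> that already contains the middle
  player \<open>b\<close>. With \<open>Y = X - {b}\<close>, the exchange then runs from
  \<open>Y\<close> plus \<open>a, b\<close> to \<open>Y\<close> plus \<open>a, c\<close> by the
  second hypothesis, and on to \<open>Y\<close> plus \<open>b, c\<close> by the first.\<close>

lemma player_equiv_trans:
  assumes ab: "(a, b) \<in> player_equiv P W" and bc: "(b, c) \<in> player_equiv P W"
  shows "(a, c) \<in> player_equiv P W"
proof -
  have P: "a \<in> P" "b \<in> P" "c \<in> P"
    using ab bc by (auto simp: player_equiv_def)
  have "insert a X \<in> W \<longleftrightarrow> insert c X \<in> W"
    if X: "X \<subseteq> P" "a \<notin> X" "c \<notin> X" for X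
  proof (cases "b \<notin> X \<or> a = c")
    case True
    then show ?thesis
      using player_equivD[OF ab X(1)] player_equivD[OF bc X(1)] X by auto
  next
    case False
    define Y where "Y = X - {b}"
    have Y: "Y \<subseteq> P" "a \<notin> Y" "b \<notin> Y" "c \<notin> Y" "X = insert b Y" "a \<noteq> c" "a \<noteq> b" "b \<noteq> c"
      using X False by (auto simp: Y_def)
    have "insert b (insert a Y) \<in> W \<longleftrightarrow> insert c (insert a Y) \<in> W"
      using player_equivD[OF bc, of "insert a Y"] Y P by auto
    moreover have "insert a (insert c Y) \<in> W \<longleftrightarrow> insert b (insert c Y) \<in> W"
      using player_equivD[OF ab, of "insert c Y"] Y P by auto
    ultimately show ?thesis
      using Y by (simp add: insert_commute)
  qed
  then show ?thesis
    using P by (auto simp: player_equiv_def)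
qed

lemma equiv_player_equiv: "equiv P (player_equiv P W)"
proof (rule equivI)
  show "player_equiv P W \<subseteq> P \<times> P"
    by (auto simp: player_equiv_def)
  show "refl_on P (player_equiv P W)"
    by (auto simp: refl_on_def player_equiv_refl)
  show "sym (player_equiv P W)"
    by (rule symI) (rule player_equiv_sym)
  show "trans (player_equiv P W)"
    by (rule transI) (rule player_equiv_trans)
qed

section \<open>Ordered parts, their levels, and activity of thresholds\<close>

locale player_partition =
  fixes P :: "'a set" and m :: nat and Part :: "nat \<Rightarrow> 'a set"
  assumes finite_players: "finite P" and partition: "indexed_partition P m Part"
begin

definition level :: "nat \<Rightarrow> 'a set" where
  "level i = (\<Union>j\<in>{1..i}. Part j)"

text \<open>The 1 in the first case turns \<open>k 1 \<le> card (Part 1)\<close> into a strict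
  inequality, so that conditions (a) and (b) and, for \<open>m \<ge> 2\<close>, the criterion for
  the absence of dummies are instances of one predicate.\<close>

definition active :: "(nat \<Rightarrow> nat) \<Rightarrow> nat \<Rightarrow> bool" where
  "active k i \<longleftrightarrow> k i < (if i = 1 then 1 else k (i - 1)) + card (Part i)"

abbreviation game :: "(nat \<Rightarrow> nat) \<Rightarrow> 'a set set" where
  "game k \<equiv> disjunctive_hierarchical P m Part k"

lemma game_iff: "X \<in> game k \<longleftrightarrow> X \<subseteq> P \<and> (\<exists>i\<in>{1..m}. k i \<le> card (X \<inter> level i))"
  by (simp add: disjunctive_hierarchical_def level_def)

lemma players_eq: "P = (\<Union>i\<in>{1..m}. Part i)"
  using partition by (simp add: indexed_partition_def)

lemma part_nonempty: "i \<in> {1..m} \<Longrightarrow> Part i \<noteq> {}"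
  using partition by (simp add: indexed_partition_def)

lemma part_unique: "p \<in> Part i \<Longrightarrow> p \<in> Part j \<Longrightarrow> i \<in> {1..m} \<Longrightarrow> j \<in> {1..m} \<Longrightarrow> i = j"
  using partition disjoint_family_onD[of Part "{1..m}" i j] by (auto simp: indexed_partition_def)

lemma part_subset: "i \<in> {1..m} \<Longrightarrow> Part i \<subseteq> P"
  by (subst players_eq) (rule UN_upper)

lemma finite_part: "i \<in> {1..m} \<Longrightarrow> finite (Part i)"
  by (rule finite_subset[OF part_subset finite_players])

lemma level_subset: "i \<le> m \<Longrightarrow> level i \<subseteq> P"
  unfolding level_def by (subst players_eq) (rule UN_mono; force)

lemma finite_level: "i \<le> m \<Longrightarrow> finite (level i)"
  by (rule finite_subset[OF level_subset finite_players])

lemma mem_level_iff: "p \<in> Part j \<Longrightarrow> j \<in> {1..m} \<Longrightarrow> i \<le> m \<Longrightarrow> p \<in> level i \<longleftrightarrow> j \<le> i"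
  unfolding level_def by (force dest: part_unique[of p j])

lemma level_Suc: "level (Suc i) = level i \<union> Part (Suc i)"
  unfolding level_def by (auto simp: atLeastAtMostSuc_conv)

lemma inj_on_Part: "inj_on Part {1..m}"
proof (rule inj_onI)
  fix i j assume "i \<in> {1..m}" "j \<in> {1..m}" "Part i = Part j"
  then show "i = j"
    using part_nonempty[of i] part_unique[of _ i j] by auto
qed

section \<open>Pivotal coalitions of active thresholds\<close>

text \<open>Activity says exactly that \<open>Part i\<close> has room for the increment
  \<open>k i - k (i - 1)\<close> (for \<open>k 1 - 1\<close> if \<open>i = 1\<close>) while one
  player \<open>p\<close> is held back. Stacking these increments gives a coalition that stays one
  short of each threshold up to \<open>i\<close>.\<close>

lemma prefix_coalition:
  assumes "thresholds m k" "1 \<le> i" "i \<le> m" "\<forall>j\<in>{1..i}. active k j" "p \<in> Part i"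
  shows "\<exists>X\<subseteq>level i. p \<notin> X \<and> Suc (card X) = k i \<and> (\<forall>j\<in>{1..<i}. card (X \<inter> level j) < k j)"
  using assms(2-5)
proof (induction i arbitrary: p rule: nat_induct_at_least)
  case base
  have "k 1 - 1 \<le> card (Part 1 - {p})"
    using base finite_part[of 1] by (simp add: active_def)
  then obtain X where "X \<subseteq> Part 1 - {p}" "card X = k 1 - 1"
    by (rule obtain_subset_with_card_n)
  \<comment> \<open>Positivity of \<open>k 1\<close> makes the truncated difference
    \<open>k 1 - 1\<close> exact.\<close>
  then show ?case
    using thresholds_pos[OF assms(1), of 1] base by (intro exI[of _ X]) (auto simp: level_def)
next
  case (Suc i)
  obtain q where q: "q \<in> Part i"
    using part_nonempty[of i] Suc by auto
  obtain Y where Y: "Y \<subseteq> level i" "Suc (card Y) = k i" "\<forall>j\<in>{1..<i}. card (Y \<inter> level j) < k j"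
    using Suc.IH[of q] Suc.prems q by auto
  have "active k (Suc i)"
    using Suc.prems by simp
  then have "k (Suc i) - k i \<le> card (Part (Suc i) - {p})"
    using Suc.prems Suc.hyps finite_part[of "Suc i"] by (simp add: active_def)
  then obtain Z where Z: "Z \<subseteq> Part (Suc i) - {p}" "card Z = k (Suc i) - k i" "finite Z"
    by (rule obtain_subset_with_card_n)
  have new: "r \<notin> level j" if "r \<in> Part (Suc i)" "j \<le> i" for r j
    using that mem_level_iff[of r "Suc i" j] Suc.prems by auto
  have "k i < k (Suc i)"
    using thresholds_less[OF assms(1), of i "Suc i"] Suc by auto
  moreover have "finite Y"
    using Y(1) finite_level[of i] Suc.prems finite_subset by auto
  moreover have "Y \<inter> Z = {}"
    using Y(1) Z(1) new by blast
  ultimately have "Suc (card (Y \<union> Z)) = k (Suc i)"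
    using Y(2) Z by (simp add: card_Un_disjoint)
  moreover have "card ((Y \<union> Z) \<inter> level j) < k j" if j: "j \<in> {1..<Suc i}" for j
  proof -
    have "(Y \<union> Z) \<inter> level j = Y \<inter> level j"
      using Z(1) new[of _ j] j by auto
    moreover have "Y \<inter> level i = Y"
      using Y(1) by blast
    \<comment> \<open>For \<open>j = i\<close> the bound comes from
      \<open>Suc (card Y) = k i\<close>; for smaller \<open>j\<close> it is inherited from
      \<open>Y\<close>.\<close>
    ultimately show ?thesis
      using Y(2,3) j by (cases "j = i") auto
  qed
  moreover have "p \<notin> Y \<union> Z" "Y \<union> Z \<subseteq> level (Suc i)"
    using Y(1) Z(1) new Suc.prems by (auto simp: level_Suc)
  ultimately show ?case
    by (intro exI[of _ "Y \<union> Z"]) blast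
qed

text \<open>The player held back is now added. It occurs in no level below \<open>i\<close>, so the
  bounds there survive.\<close>

lemma pivotal_coalition:
  assumes "thresholds m k" "1 \<le> i" "i \<le> m" "\<forall>j\<in>{1..i}. active k j" "p \<in> Part i"
  obtains S where "S \<subseteq> level i" "p \<in> S" "card S = k i" "\<forall>j\<in>{1..<i}. card (S \<inter> level j) < k j"
proof -
  obtain X where X: "X \<subseteq> level i" "p \<notin> X" "Suc (card X) = k i"
    "\<forall>j\<in>{1..<i}. card (X \<inter> level j) < k j"
    using prefix_coalition[OF assms] by blast
  have "finite X"
    using X(1) finite_level assms(3) finite_subset by blast
  moreover have "p \<in> level j \<longleftrightarrow> i \<le> j" if "j \<le> m" for j
    using mem_level_iff[of p i j] assms that by auto
  ultimately show ?thesis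
    using X assms(3) by (intro that[of "insert p X"]) auto
qed

lemma pivotal_wins:
  assumes "1 \<le> i" "i \<le> m" "S \<subseteq> level i" "card S = k i"
  shows "S \<in> game k"
proof -
  have "S \<inter> level i = S"
    using assms by blast
  then show ?thesis
    unfolding game_iff using assms level_subset[of i] by (intro conjI bexI[of _ i]) auto
qed

text \<open>A proper subset stays below the thresholds before \<open>i\<close> because
  \<open>S\<close> does. From \<open>i\<close> on it fails by size: it has fewer than
  \<open>k i\<close> players, and later thresholds are no smaller.\<close>

lemma pivotal_minimal:
  assumes k: "thresholds m k" and i: "1 \<le> i" "i \<le> m"
    and S: "S \<subseteq> level i" "card S = k i" "\<forall>j\<in>{1..<i}. card (S \<inter> level j) < k j"
  shows "minimal_winning (game k) S"
proof -
  have fin: "finite S"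
    using S(1) finite_level[OF i(2)] finite_subset by blast
  have "Y \<notin> game k" if Y: "Y \<subset> S" for Y
  proof -
    have "card (Y \<inter> level j) < k j" if j: "j \<in> {1..m}" for j
    proof (cases "j < i")
      case True
      have "card (Y \<inter> level j) \<le> card (S \<inter> level j)"
        using fin Y by (intro card_mono) auto
      moreover have "j \<in> {1..<i}"
        using True j by simp
      ultimately show ?thesis
        using bspec[OF S(3)] by fastforce
    next
      case False
      have "card (Y \<inter> level j) \<le> card Y"
        using fin Y by (intro card_mono) (auto intro: finite_subset)
      also have "\<dots> < k i"
        using psubset_card_mono[OF fin Y] S(2) by simp
      also have "\<dots> \<le> k j"
        using thresholds_le[OF k, of i j] i j False by simp
      finally show ?thesis .
    qed
    then show ?thesis
      unfolding game_iff by (meson not_less)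
  qed
  then show ?thesis
    using pivotal_wins[of i S k] i S by (simp add: minimal_winning_def)
qed

lemma active_not_dummy:
  assumes "thresholds m k" "1 \<le> i" "i \<le> m" "\<forall>j\<in>{1..i}. active k j" "p \<in> Part i"
  shows "\<not> dummy P (game k) p"
proof -
  obtain S where S: "S \<subseteq> level i" "p \<in> S" "card S = k i"
    "\<forall>j\<in>{1..<i}. card (S \<inter> level j) < k j"
    using pivotal_coalition[OF assms] .
  then show ?thesis
    using pivotal_minimal[OF assms(1-3) S(1,3,4)] by (auto simp: dummy_def)
qed

text \<open>Exchange \<open>p\<close> for \<open>q\<close> in a pivotal coalition of threshold
  \<open>i\<close>. Levels before \<open>i\<close> do not see \<open>q\<close> and so gain nothing,
  level \<open>i\<close> loses \<open>p\<close>, and for the later thresholds the total size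
  \<open>k i\<close> is too small. The new coalition therefore loses.\<close>

lemma active_not_equiv:
  assumes k: "thresholds m k" and i: "1 \<le> i" "i < j" "j \<le> m"
    and act: "\<forall>l\<in>{1..i}. active k l" and p: "p \<in> Part i" and q: "q \<in> Part j"
  shows "(p, q) \<notin> player_equiv P (game k)"
proof
  assume equiv: "(p, q) \<in> player_equiv P (game k)"
  have im: "i \<le> m"
    using i by simp
  obtain S where S: "S \<subseteq> level i" "p \<in> S" "card S = k i"
    "\<forall>l\<in>{1..<i}. card (S \<inter> level l) < k l"
    using pivotal_coalition[OF k i(1) im act p] .
  have fin: "finite S"
    using S(1) finite_level[OF im] finite_subset by blast
  have q_level: "q \<in> level l \<longleftrightarrow> j \<le> l" if "l \<le> m" for l
    using mem_level_iff[OF q _ that] i by auto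
  have q_new: "q \<notin> S"
    using q_level[OF im] S(1) i by auto
  have "S - {p} \<subseteq> P"
    using S(1) level_subset[OF im] by blast
  then have "insert q (S - {p}) \<in> game k"
    using player_equivD[OF equiv, of "S - {p}"] pivotal_wins[of i S k] q_new S i(1) im
    by (simp add: insert_absorb)
  then obtain l where l: "l \<in> {1..m}" "k l \<le> card (insert q (S - {p}) \<inter> level l)"
    unfolding game_iff by blast
  consider "l < i" | "l = i" | "i < l"
    by linarith
  then show False
  proof cases
    case 1
    have "card (insert q (S - {p}) \<inter> level l) \<le> card (S \<inter> level l)"
      using q_level[of l] l 1 i fin by (intro card_mono) auto
    moreover have "l \<in> {1..<i}"
      using 1 l(1) by simp
    ultimately show False
      using bspec[OF S(4)] l(2) by fastforce
  next
    case 2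
    have "card (insert q (S - {p}) \<inter> level l) \<le> card (S - {p})"
      using q_level[of l] l 2 i fin by (intro card_mono) auto
    also have "\<dots> < k i"
      using card_Diff1_less[OF fin S(2)] S(3) by simp
    finally show False
      using l 2 by simp
  next
    case 3
    have "card (insert q (S - {p}) \<inter> level l) \<le> card (insert q (S - {p}))"
      using fin by (intro card_mono) auto
    also have "\<dots> = k i"
      using card.remove[OF fin S(2)] fin S(3) q_new by simp
    also have "\<dots> < k l"
      using thresholds_less[OF k, of i l] l 3 i by simp
    finally show False
      using l by simp
  qed
qed

section \<open>Uniqueness of the thresholds\<close>

text \<open>A pivotal coalition of \<open>k i\<close> also wins under \<open>k'\<close>. It reaches
  no earlier threshold, as these agree, so it reaches \<open>k' l\<close> for some
  \<open>l \<ge> i\<close>, and \<open>k' i \<le> k' l \<le> k i\<close>.\<close>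

lemma game_eq_threshold_le:
  assumes k: "thresholds m k" and k': "thresholds m k'" and eq: "game k = game k'"
    and i: "1 \<le> i" "i \<le> m" and act: "\<forall>l\<in>{1..i}. active k l"
    and agree: "\<forall>j\<in>{1..<i}. k' j = k j"
  shows "k' i \<le> k i"
proof -
  obtain p where p: "p \<in> Part i"
    using part_nonempty[of i] i by auto
  obtain S where S: "S \<subseteq> level i" "p \<in> S" "card S = k i"
    "\<forall>j\<in>{1..<i}. card (S \<inter> level j) < k j"
    using pivotal_coalition[OF k i act p] .
  have "S \<in> game k'"
    using pivotal_wins[where k = k, OF i S(1,3)] eq by simp
  then obtain l where l: "l \<in> {1..m}" "k' l \<le> card (S \<inter> level l)"
    unfolding game_iff by blast
  have "\<not> l < i"
  proof
    assume "l < i"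
    then have "l \<in> {1..<i}"
      using l(1) by simp
    then show False
      using bspec[OF S(4)] bspec[OF agree] l(2) by fastforce
  qed
  then have "k' i \<le> k' l"
    using thresholds_le[OF k', of i l] i l by simp
  also have "\<dots> \<le> card (S \<inter> level l)"
    by (rule l)
  also have "\<dots> \<le> card S"
    using S(1) finite_level[OF i(2)] by (intro card_mono) (auto intro: finite_subset)
  finally show ?thesis
    using S(3) by simp
qed

text \<open>Each sequence bounds the other, which is why activity is assumed for both. The bound
  \<open>b\<close> will be \<open>m - 1\<close> in general and \<open>m\<close> when there are no
  dummies.\<close>

lemma game_eq_thresholds_eq:
  assumes k: "thresholds m k" and k': "thresholds m k'" and eq: "game k = game k'"
    and b: "b \<le> m" and act: "\<forall>l\<in>{1..b}. active k l" "\<forall>l\<in>{1..b}. active k' l"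
  shows "1 \<le> i \<Longrightarrow> i \<le> b \<Longrightarrow> k' i = k i"
proof (induction i rule: less_induct)
  case (less i)
  then have "\<forall>j\<in>{1..<i}. k' j = k j"
    by auto
  then show ?case
    using less.prems b act
    by (intro antisym game_eq_threshold_le[OF k k' eq] game_eq_threshold_le[OF k' k eq[symmetric]])
      auto
qed

section \<open>Redundancy of inactive thresholds\<close>

text \<open>Dropping \<open>Part i\<close> costs at most \<open>card (Part i)\<close> players, and
  inactivity guarantees that at least \<open>k (i - 1)\<close> remain in the level before.\<close>

lemma inactive_redundant:
  assumes i: "i \<in> {1..m}" and inact: "\<not> active k i" and X: "k i \<le> card (X \<inter> level i)"
    and k: "thresholds m k"
  shows "\<exists>j\<in>{1..<i}. k j \<le> card (X \<inter> level j)"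
proof -
  obtain j where j: "i = Suc j"
    using i by (cases i) auto
  have "X \<inter> level i \<subseteq> (X \<inter> level j) \<union> Part i"
    by (auto simp: level_Suc j)
  moreover have "finite (level j)" "finite (Part i)"
    using finite_level[of j] finite_part[of i] i j by auto
  ultimately have "card (X \<inter> level i) \<le> card ((X \<inter> level j) \<union> Part i)"
    by (intro card_mono) auto
  also have "\<dots> \<le> card (X \<inter> level j) + card (Part i)"
    by (rule card_Un_le)
  finally have *: "k i \<le> card (X \<inter> level j) + card (Part i)"
    using X by simp
  \<comment> \<open>Since \<open>level 0\<close> is empty, reaching the first threshold would
    require \<open>k 1 \<le> card (Part 1)\<close>, contrary to inactivity.\<close>
  have "j \<noteq> 0"
  proof
    assume "j = 0"
    then show False
      using * inact thresholds_pos[OF k i] j by (simp add: active_def level_def)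
  qed
  then show ?thesis
    using * inact j by (intro bexI[of _ j]) (auto simp: active_def)
qed

text \<open>Both effects of inactivity, merged neighbouring parts and dummies in the last part, are
  read off this form with index \<open>i\<close> deleted.\<close>

lemma inactive_game_iff:
  assumes "thresholds m k" "i \<in> {1..m}" "\<not> active k i"
  shows "X \<in> game k \<longleftrightarrow> X \<subseteq> P \<and> (\<exists>l\<in>{1..m} - {i}. k l \<le> card (X \<inter> level l))"
proof -
  have "\<exists>l\<in>{1..m} - {i}. k l \<le> card (X \<inter> level l)"
    if l: "l \<in> {1..m}" "k l \<le> card (X \<inter> level l)" for l
  proof (cases "l = i")
    case True
    then obtain j where "j \<in> {1..<i}" "k j \<le> card (X \<inter> level j)"
      using inactive_redundant[OF assms(2,3) _ assms(1)] l by blast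
    then show ?thesis
      using assms(2) by (intro bexI[of _ j]) auto
  qed (use l in blast)
  then show ?thesis
    unfolding game_iff by blast
qed

lemma card_insert_level:
  assumes "p \<in> Part i" "i \<in> {1..m}" "p \<notin> X" "l \<le> m"
  shows "card (insert p X \<inter> level l) = card (X \<inter> level l) + (if i \<le> l then 1 else 0)"
proof -
  have "p \<in> level l \<longleftrightarrow> i \<le> l"
    using mem_level_iff[OF assms(1,2,4)] .
  then show ?thesis
    using assms finite_level[OF assms(4)] by auto
qed

lemma same_part_equiv:
  assumes "i \<in> {1..m}" "p \<in> Part i" "q \<in> Part i"
  shows "(p, q) \<in> player_equiv P (game k)"
proof -
  have P: "p \<in> P" "q \<in> P"
    using assms part_subset by blast+
  have "insert p X \<in> game k \<longleftrightarrow> insert q X \<in> game k"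
    if "X \<subseteq> P" "p \<notin> X" "q \<notin> X" for X
    unfolding game_iff using that P assms card_insert_level[OF assms(2,1) that(2)]
      card_insert_level[OF assms(3,1) that(3)] by auto
  then show ?thesis
    using P by (simp add: player_equiv_def)
qed

text \<open>Only \<open>level i\<close> distinguishes players of these two neighbouring parts, and
  the threshold there can be deleted.\<close>

lemma inactive_equiv_next:
  assumes k: "thresholds m k" and i: "1 \<le> i" "i < m" and inact: "\<not> active k i"
    and p: "p \<in> Part i" and q: "q \<in> Part (Suc i)"
  shows "(p, q) \<in> player_equiv P (game k)"
proof -
  have im: "i \<in> {1..m}" "Suc i \<in> {1..m}"
    using i by auto
  have P: "p \<in> P" "q \<in> P"
    using p q im part_subset by blast+
  have "insert p X \<in> game k \<longleftrightarrow> insert q X \<in> game k"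
    if X: "X \<subseteq> P" "p \<notin> X" "q \<notin> X" for X
  proof -
    have "card (insert p X \<inter> level l) = card (insert q X \<inter> level l)" if "l \<in> {1..m} - {i}" for l
      using that card_insert_level[OF p im(1) X(2), of l] card_insert_level[OF q im(2) X(3), of l]
      by auto
    then show ?thesis
      unfolding inactive_game_iff[OF k im(1) inact] using X P by auto
  qed
  then show ?thesis
    using P by (simp add: player_equiv_def)
qed

section \<open>Equivalence classes and their number\<close>

text \<open>Two different parts are separated at the earlier of their indices, which is below
  \<open>m\<close>; hence activity of the last threshold does not enter.\<close>

lemma quotient_active:
  assumes k: "thresholds m k" and act: "\<forall>i\<in>{1..<m}. active k i"
  shows "P // player_equiv P (game k) = Part ` {1..m}"
proof -
  have cls: "player_equiv P (game k) `` {p} = Part i" if i: "i \<in> {1..m}" "p \<in> Part i" for i p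
  proof (intro equalityI subsetI)
    fix q assume "q \<in> player_equiv P (game k) `` {p}"
    then have pq: "(p, q) \<in> player_equiv P (game k)"
      by simp
    then have "q \<in> P"
      by (simp add: player_equiv_def)
    then obtain j where j: "j \<in> {1..m}" "q \<in> Part j"
      using players_eq by blast
    have "\<not> i < j"
      using active_not_equiv[OF k, of i j p q] i j pq act by auto
    moreover have "\<not> j < i"
      using active_not_equiv[OF k, of j i q p] i j player_equiv_sym[OF pq] act by auto
    ultimately show "q \<in> Part i"
      using j by simp
  qed (use same_part_equiv[OF i] in auto)
  show ?thesis
  proof (intro equalityI subsetI)
    fix C assume "C \<in> P // player_equiv P (game k)"
    then obtain p where "p \<in> P" "C = player_equiv P (game k) `` {p}"
      by (rule quotientE)
    then show "C \<in> Part ` {1..m}"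
      using cls players_eq by blast
  next
    fix C assume "C \<in> Part ` {1..m}"
    then obtain i where i: "i \<in> {1..m}" "C = Part i"
      by blast
    then obtain p where "p \<in> Part i"
      using part_nonempty by blast
    then have "p \<in> P" "player_equiv P (game k) `` {p} = C"
      using cls[OF i(1)] i part_subset[OF i(1)] by auto
    then show "C \<in> P // player_equiv P (game k)"
      by (auto intro: quotientI)
  qed
qed

text \<open>Every class is the class of some part, and the parts \<open>i\<close> and
  \<open>Suc i\<close> share theirs, so \<open>m - 1\<close> indices cover the quotient.\<close>

lemma card_quotient_inactive:
  assumes k: "thresholds m k" and i: "i \<in> {1..<m}" and inact: "\<not> active k i"
  shows "card (P // player_equiv P (game k)) < m"
proof -
  let ?r = "player_equiv P (game k)"
  have "\<forall>j\<in>{1..m}. \<exists>p. p \<in> Part j"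
    using part_nonempty by blast
  then obtain g where g: "\<And>j. j \<in> {1..m} \<Longrightarrow> g j \<in> Part j"
    by metis
  define f where "f j = ?r `` {g j}" for j
  have same: "f i = f (Suc i)"
    unfolding f_def using inactive_equiv_next[OF k, of i] i inact g
    by (intro equiv_class_eq[OF equiv_player_equiv]) auto
  have "P // ?r \<subseteq> f ` ({1..m} - {i})"
  proof
    fix C assume "C \<in> P // ?r"
    then obtain p where p: "p \<in> P" "C = ?r `` {p}"
      by (rule quotientE)
    then obtain j where j: "j \<in> {1..m}" "p \<in> Part j"
      using players_eq by blast
    have "C = f j"
      unfolding f_def p(2) using same_part_equiv j g
      by (intro equiv_class_eq[OF equiv_player_equiv]) auto
    then show "C \<in> f ` ({1..m} - {i})"
      using same j i by (cases "j = i") auto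
  qed
  then have "card (P // ?r) \<le> card (f ` ({1..m} - {i}))"
    by (intro card_mono) auto
  also have "\<dots> \<le> card ({1..m} - {i})"
    by (rule card_image_le) simp
  also have "\<dots> < m"
    using i by simp
  finally show ?thesis .
qed

lemma card_quotient_iff:
  assumes "thresholds m k"
  shows "card (P // player_equiv P (game k)) = m \<longleftrightarrow> (\<forall>i\<in>{1..<m}. active k i)"
proof
  assume "card (P // player_equiv P (game k)) = m"
  then show "\<forall>i\<in>{1..<m}. active k i"
    using card_quotient_inactive[OF assms] by (metis less_irrefl)
next
  assume "\<forall>i\<in>{1..<m}. active k i"
  then show "card (P // player_equiv P (game k)) = m"
    using card_image[OF inj_on_Part] by (simp add: quotient_active[OF assms])
qed

section \<open>Dummy players\<close>

text \<open>A winning coalition reaches a threshold other than the last. The corresponding level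
  misses \<open>p\<close>, so deleting \<open>p\<close> keeps the coalition winning, and none
  containing \<open>p\<close> is minimal.\<close>

lemma inactive_last_dummy:
  assumes k: "thresholds m k" and m: "1 \<le> m" and inact: "\<not> active k m" and p: "p \<in> Part m"
  shows "dummy P (game k) p"
proof -
  have pP: "p \<in> P"
    using p part_subset[of m] m by auto
  have "p \<notin> X" if X: "minimal_winning (game k) X" for X
  proof
    assume pX: "p \<in> X"
    have "X \<in> game k"
      using X by (simp add: minimal_winning_def)
    moreover have "m \<in> {1..m}"
      using m by simp
    ultimately obtain l where l: "l \<in> {1..m} - {m}" "k l \<le> card (X \<inter> level l)" and XP: "X \<subseteq> P"
      using inactive_game_iff[OF k _ inact, of X] by blast
    have "p \<notin> level l"
      using mem_level_iff[OF p, of l] l m by auto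
    then have "(X - {p}) \<inter> level l = X \<inter> level l"
      by blast
    then have "X - {p} \<in> game k"
      unfolding game_iff using l XP by (intro conjI bexI[of _ l]) auto
    moreover have "X - {p} \<subset> X"
      using pX by blast
    ultimately show False
      using X by (simp add: minimal_winning_def)
  qed
  then show ?thesis
    using pP by (auto simp: dummy_def)
qed

lemma no_dummy_iff:
  assumes k: "thresholds m k" and m: "1 \<le> m" and act: "\<forall>i\<in>{1..<m}. active k i"
  shows "(\<nexists>p. dummy P (game k) p) \<longleftrightarrow> active k m"
proof
  assume "\<nexists>p. dummy P (game k) p"
  then show "active k m"
    using inactive_last_dummy[OF k m] part_nonempty[of m] m by force
next
  assume "active k m"
  then have act': "active k j" if "j \<in> {1..m}" for j
    using act that by (cases "j = m") auto
  show "\<nexists>p. dummy P (game k) p"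
  proof
    assume "\<exists>p. dummy P (game k) p"
    then obtain p where p: "dummy P (game k) p"
      by blast
    then have "p \<in> P"
      by (simp add: dummy_def)
    then obtain i where "i \<in> {1..m}" "p \<in> Part i"
      using players_eq by blast
    then show False
      using active_not_dummy[OF k, of i p] act' p by auto
  qed
qed

text \<open>For \<open>m = 1\<close> the range \<open>{1..<m}\<close> is empty, so activity on it
  does not contain condition (a); nonemptiness of the game supplies it.\<close>

lemma first_active:
  assumes "game k \<noteq> {}" "m = 1"
  shows "active k 1"
proof -
  obtain X where "X \<in> game k"
    using assms(1) by blast
  then have "k 1 \<le> card (X \<inter> level 1)"
    using game_iff[of X k] assms(2) by auto
  also have "\<dots> \<le> card (Part 1)"
    using finite_part[of 1] assms(2) by (intro card_mono) (auto simp: level_def)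
  finally show ?thesis
    by (simp add: active_def)
qed

end

text \<open>The guard \<open>2 \<le> m\<close> avoids \<open>k 0\<close>, about which nothing is
  assumed. Uniqueness of the last threshold is derived from the absence of dummies, which makes
  sense for \<open>m = 1\<close> as well.\<close>

theorem theorem3:
  fixes P :: "'a set" and Part :: "nat \<Rightarrow> 'a set"
    and m :: nat and n k :: "nat \<Rightarrow> nat" and H :: "'a set set"
  assumes "finite P" and "1 \<le> m"
    and "indexed_partition P m Part"
    and "\<And>i. i \<in> {1..m} \<Longrightarrow> n i = card (Part i)"
    and "thresholds m k"
    and "H = disjunctive_hierarchical P m Part k"
    and "simple_game P H"
  shows
    "(card (P // player_equiv P H) = m \<longleftrightarrow>
        k 1 \<le> n 1 \<and> (\<forall>i. 1 < i \<and> i < m \<longrightarrow> k i < k (i - 1) + n i)) \<and>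
     (card (P // player_equiv P H) = m \<longrightarrow>
        P // player_equiv P H = Part ` {1..m} \<and>
        (\<exists>V. canonical_representation P H m (power_multiset m n) V)) \<and>
     (k 1 \<le> n 1 \<and> (\<forall>i. 1 < i \<and> i < m \<longrightarrow> k i < k (i - 1) + n i) \<longrightarrow>
        (\<forall>k'. thresholds m k' \<and> disjunctive_hierarchical P m Part k' = H \<longrightarrow>
           (\<forall>i. 1 \<le> i \<and> i \<le> m - 1 \<longrightarrow> k' i = k i)) \<and>
        (2 \<le> m \<longrightarrow> ((\<nexists>p. dummy P H p) \<longleftrightarrow> k m < k (m - 1) + n m)) \<and>
        ((\<nexists>p. dummy P H p) \<longrightarrow>
           (\<forall>k'. thresholds m k' \<and> disjunctive_hierarchical P m Part k' = H \<longrightarrow> k' m = k m)) \<and>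
        (2 \<le> m \<and> k (m - 1) + n m \<le> k m \<longrightarrow> (\<forall>p\<in>Part m. dummy P H p)))"
proof -
  interpret player_partition P m Part
    using assms by unfold_locales
  have k: "thresholds m k" and H: "H = game k" and m: "1 \<le> m"
    using assms by auto
  have nonempty: "H \<noteq> {}"
    using assms(7) by (simp add: simple_game_def)
  let ?classes = "P // player_equiv P H"
  have activity: "k 1 \<le> n 1 \<and> (\<forall>i. 1 < i \<and> i < m \<longrightarrow> k i < k (i - 1) + n i) \<longleftrightarrow>
      (\<forall>i\<in>{1..<m}. active k i)" (is "?ab \<longleftrightarrow> _")
  proof -
    have "active k 1 \<longleftrightarrow> k 1 \<le> n 1"
      using assms(4)[of 1] m by (auto simp: active_def)
    moreover have "active k i \<longleftrightarrow> k i < k (i - 1) + n i" if "1 < i" "i < m" for i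
      using assms(4)[of i] that by (auto simp: active_def)
    moreover have "(\<forall>i\<in>{1..<m}. active k i) \<longleftrightarrow>
        active k 1 \<and> (\<forall>i. 1 < i \<and> i < m \<longrightarrow> active k i)"
    proof (cases "m = 1")
      case True
      then show ?thesis
        using first_active[of k] nonempty H by auto
    next
      case False
      then have "{1..<m} = insert 1 {i. 1 < i \<and> i < m}"
        using m by auto
      then show ?thesis
        by simp
    qed
    ultimately show ?thesis
      by simp
  qed
  have card_iff: "card ?classes = m \<longleftrightarrow> ?ab"
    unfolding activity H by (rule card_quotient_iff[OF k])
  have classes: "?classes = Part ` {1..m}" if "card ?classes = m"
    using that quotient_active[OF k] unfolding H card_quotient_iff[OF k] by simp
  have canonical: "\<exists>V. canonical_representation P H m (power_multiset m n) V"
    if "card ?classes = m"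
  proof -
    have "bij_betw Part {1..m} ?classes"
      using classes[OF that] inj_on_Part by (simp add: bij_betw_def)
    moreover have "power_multiset m n = power_multiset m (\<lambda>i. card (Part i))"
      using assms(4) by (simp add: power_multiset_def)
    ultimately show ?thesis
      unfolding canonical_representation_def by blast
  qed
  have last_active: "active k m \<longleftrightarrow> k m < k (m - 1) + n m" if "2 \<le> m"
    using assms(4)[of m] that by (auto simp: active_def)
  have act: "\<forall>i\<in>{1..<m}. active k i" if ?ab
    using that activity by simp
  \<comment> \<open>The number of classes depends on the game alone, so it forces activity for every
    sequence \<open>k'\<close> defining \<open>H\<close>.\<close>
  have act': "\<forall>i\<in>{1..<m}. active k' i" if ?ab "thresholds m k'" "game k' = H" for k'
    using that card_iff card_quotient_iff[OF that(2)] by simp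
  have unique: "k' i = k i"
    if "?ab" "thresholds m k'" "game k' = H" "1 \<le> i" "i \<le> m - 1" for k' i
  proof (rule game_eq_thresholds_eq[OF k that(2)])
    show "\<forall>l\<in>{1..m - 1}. active k l" "\<forall>l\<in>{1..m - 1}. active k' l"
      using act[OF that(1)] act'[OF that(1-3)] m by auto
  qed (use that H in auto)
  have no_dummy: "(\<nexists>p. dummy P H p) \<longleftrightarrow> active k m" if ?ab
    unfolding H using no_dummy_iff[OF k m act[OF that]] .
  have no_dummy_last: "(\<nexists>p. dummy P H p) \<longleftrightarrow> k m < k (m - 1) + n m" if ?ab "2 \<le> m"
    using no_dummy last_active that by simp
  have unique_last: "k' m = k m"
    if "?ab" "\<nexists>p. dummy P H p" "thresholds m k'" "game k' = H" for k'
  proof (rule game_eq_thresholds_eq[OF k that(3)])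
    \<comment> \<open>Likewise, absence of dummies is a property of \<open>H\<close> and makes the
      last threshold active for both sequences.\<close>
    have "active k m" "active k' m"
      using that no_dummy no_dummy_iff[OF that(3) m act'[OF that(1,3,4)]] by simp_all
    moreover have "{1..m} = insert m {1..<m}"
      using m by auto
    ultimately show "\<forall>l\<in>{1..m}. active k l" "\<forall>l\<in>{1..m}. active k' l"
      using act[OF that(1)] act'[OF that(1,3,4)] by simp_all
  qed (use that H m in auto)
  have last_dummy: "dummy P H p" if "2 \<le> m" "k (m - 1) + n m \<le> k m" "p \<in> Part m" for p
    unfolding H using inactive_last_dummy[OF k m] last_active that by simp
  show ?thesis
  proof (intro conjI impI allI ballI)
    show "card ?classes = m \<longleftrightarrow> ?ab"
      by (rule card_iff)
  qed ((rule classes canonical no_dummy_last unique_last unique last_dummy; blast)+)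
qed

end
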